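(* Let $a<0$, $\tau>0$, and consider the scalar time-delay system $\dot x(t)=a\,x(t)+a\,x(t-\tau)+u(t)$, $y(t)=x(t)$, with transfer function $$G(s)=\bigl(s-a(1+e^{-\tau s})\bigr)^{-1}.$$ Let $\{\phi_k\}_{k\ge0}$ be a degree-graded orthogonal polynomial sequence on $[-\tau,0]$ such that $\phi_k(-\tau-\theta)=(-1)^k\phi_k(\theta)$ for all $\theta\in[-\tau,0]$ and all $k\ge0$. For $N\ge1$ let $G_N$ be the transfer function of the Lanczos tau discretization of degree $N$ of this system with respect to $\{\phi_k\}$, assumed exponentially stable. Then $$\|G_N\|_{H^2}=\|G\|_{H^2}.$$
   Context: Orthogonal polynomials: $\langle f,g\rangle=\int_{-\tau}^0 f(\theta)\overline{g(\theta)}\,w(\theta)\,d\theta$, with $w\ge0$ an integrable weight that is positive on a set of positive measure, $\|f\|=\sqrt{\langle f,f\rangle}$; $\phi_k$ has degree exactly $k$ and $\langle\phi_j,\phi_k\rangle=0$ iff $j\ne k$. $\mathbb P_N$ denotes the complex polynomials on $[-\tau,0]$ of degree at most $N$; $\varepsilon_\theta f=f(\theta)$; $\mathcal D f=f'$; $\mathcal T_{N-1}:\mathbb P_N\to\mathbb P_{N-1}$, $\mathcal T_{N-1}f=f-\frac{\langle f,\phi_N\rangle}{\|\phi_N\|^2}\phi_N$. The Lanczos tau discretization of degree $N$ is the system for $\xi_{tN}\in\mathbb P_N$ $$\begin{pmatrix}\varepsilon_0\\ \mathcal T_{N-1}\end{pmatrix}\tfrac{d}{dt}\xi_{tN}=\begin{pmatrix}a\varepsilon_0+a\varepsilon_{-\tau}\\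 \mathcal D\end{pmatrix}\xi_{tN}+\begin{pmatrix}1\\ \mathbf 0\end{pmatrix}u(t),\qquad y_N(t)=\varepsilon_0\xi_{tN},$$ with transfer function $$G_N(s)=\varepsilon_0\begin{pmatrix}s\varepsilon_0-a\varepsilon_0-a\varepsilon_{-\tau}\\ s\mathcal T_{N-1}-\mathcal D\end{pmatrix}^{-1}\begin{pmatrix}1\\ \mathbf 0\end{pmatrix},$$ where the column is the linear map $\mathbb P_N\to\mathbb C\times\mathbb P_{N-1}$ sending $f$ to $\bigl(sf(0)-af(0)-af(-\tau),\ s\mathcal T_{N-1}f-f'\bigr)$. The discretization is exponentially stable if this linear map is invertible for every $s$ with $\operatorname{Re}s\ge0$ (the original delay system is exponentially stable for all $a<0$, $\tau\ge 0$). The $H^2$-norm of an exponentially stable system with scalar transfer function $H$ is $\|H\|_{H^2}=\left(\frac1{2\pi}\int_{-\infty}^{\infty}|H(i\omega)|^2\,d\omega\right)^{1/2}$. *)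

theory Defs
  imports "HOL-Analysis.Analysis" "HOL-Computational_Algebra.Polynomial"
begin

definition weight_on :: "real \<Rightarrow> (real \<Rightarrow> real) \<Rightarrow> bool" where
  "weight_on \<tau> w \<longleftrightarrow>
     (\<forall>\<theta>\<in>{-\<tau>..0}. 0 \<le> w \<theta>) \<and>
     set_integrable lebesgue {-\<tau>..0} w \<and>
     0 < emeasure lebesgue {\<theta>\<in>{-\<tau>..0}. 0 < w \<theta>}"

text \<open>Polynomial functions on the interval from \<open>-\<tau>\<close> to \<open>0\<close> are represented by elements of
  \<open>complex poly\<close>, evaluated at real points; for \<open>\<tau> > 0\<close> this representation is faithful.\<close>

definition inner_w :: "real \<Rightarrow> (real \<Rightarrow> real) \<Rightarrow> complex poly \<Rightarrow> complex poly \<Rightarrow> complex" where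
  "inner_w \<tau> w f g =
     set_lebesgue_integral lebesgue {-\<tau>..0}
       (\<lambda>\<theta>. poly f (of_real \<theta>) * cnj (poly g (of_real \<theta>)) * of_real (w \<theta>))"

definition norm_w :: "real \<Rightarrow> (real \<Rightarrow> real) \<Rightarrow> complex poly \<Rightarrow> real" where
  "norm_w \<tau> w f = sqrt (Re (inner_w \<tau> w f f))"

definition orthogonal_poly_seq ::
    "real \<Rightarrow> (real \<Rightarrow> real) \<Rightarrow> (nat \<Rightarrow> complex poly) \<Rightarrow> bool" where
  "orthogonal_poly_seq \<tau> w \<phi> \<longleftrightarrow>
     (\<forall>k. degree (\<phi> k) = k) \<and>
     (\<forall>j k. inner_w \<tau> w (\<phi> j) (\<phi> k) = 0 \<longleftrightarrow> j \<noteq> k)"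

definition polys_upto :: "nat \<Rightarrow> complex poly set" where
  "polys_upto N = {p. degree p \<le> N}"

text \<open>\<open>tau_trunc\<close> is indexed by its domain degree \<open>N\<close>; it maps into degree at most \<open>N - 1\<close>.\<close>

definition tau_trunc ::
    "real \<Rightarrow> (real \<Rightarrow> real) \<Rightarrow> (nat \<Rightarrow> complex poly) \<Rightarrow> nat \<Rightarrow> complex poly \<Rightarrow> complex poly" where
  "tau_trunc \<tau> w \<phi> N f =
     f - smult (inner_w \<tau> w f (\<phi> N) / of_real ((norm_w \<tau> w (\<phi> N))\<^sup>2)) (\<phi> N)"

definition tau_map ::
    "real \<Rightarrow> real \<Rightarrow> (real \<Rightarrow> real) \<Rightarrow> (nat \<Rightarrow> complex poly) \<Rightarrow> nat \<Rightarrow> complex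
     \<Rightarrow> complex poly \<Rightarrow> complex \<times> complex poly" where
  "tau_map a \<tau> w \<phi> N s f =
     (s * poly f 0 - of_real a * poly f 0 - of_real a * poly f (of_real (-\<tau>)),
      smult s (tau_trunc \<tau> w \<phi> N f) - pderiv f)"

definition tau_exp_stable ::
    "real \<Rightarrow> real \<Rightarrow> (real \<Rightarrow> real) \<Rightarrow> (nat \<Rightarrow> complex poly) \<Rightarrow> nat \<Rightarrow> bool" where
  "tau_exp_stable a \<tau> w \<phi> N \<longleftrightarrow>
     (\<forall>s. 0 \<le> Re s \<longrightarrow>
        bij_betw (tau_map a \<tau> w \<phi> N s) (polys_upto N) (UNIV \<times> polys_upto (N - 1)))"

text \<open>The inverse is meaningful only for those \<open>s\<close> at which the map is a bijection between the
  spaces in \<open>tau_exp_stable\<close>; elsewhere the value is unspecified.\<close>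

definition tau_transfer ::
    "real \<Rightarrow> real \<Rightarrow> (real \<Rightarrow> real) \<Rightarrow> (nat \<Rightarrow> complex poly) \<Rightarrow> nat \<Rightarrow> complex \<Rightarrow> complex" where
  "tau_transfer a \<tau> w \<phi> N s = poly (inv_into (polys_upto N) (tau_map a \<tau> w \<phi> N s) (1, 0)) 0"

definition delay_transfer :: "real \<Rightarrow> real \<Rightarrow> complex \<Rightarrow> complex" where
  "delay_transfer a \<tau> s = inverse (s - of_real a * (1 + exp (- of_real \<tau> * s)))"

text \<open>The Bochner integral of a non-integrable function is \<open>0\<close>, so \<open>H2_norm\<close> is the norm only
  under \<open>H2_finite\<close>.\<close>

definition H2_finite :: "(complex \<Rightarrow> complex) \<Rightarrow> bool" where
  "H2_finite H \<longleftrightarrow> integrable lebesgue (\<lambda>\<omega>. (cmod (H (\<i> * of_real \<omega>)))\<^sup>2)"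

definition H2_norm :: "(complex \<Rightarrow> complex) \<Rightarrow> real" where
  "H2_norm H =
     sqrt (1 / (2 * pi) * integral\<^sup>L lebesgue (\<lambda>\<omega>. (cmod (H (\<i> * of_real \<omega>)))\<^sup>2))"

end

theory Submission
  imports Defs "HOL-Complex_Analysis.Complex_Analysis" "HOL-Probability.Sinc_Integral"
begin

text \<open>
  Both transfer functions have the form \<open>G s = P s / ((s - a) * P s - a * P (- s))\<close> with an entire
  \<open>P\<close> satisfying \<open>cnj (P (\<i> \<omega>)) = u * P (- \<i> \<omega>)\<close> and \<open>P' 0 = \<tau> / 2 * P 0\<close>: for the delay system
  \<open>P s = exp (\<tau> s / 2)\<close>, for the tau discretization \<open>P s = (\<Sum>k\<le>N. s ^ (N - k) * \<phi>\<^sub>N\<^sup>(\<^sup>k\<^sup>) 0)\<close>, where the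
  symmetry of \<open>\<phi>\<^sub>N\<close> about \<open>- \<tau> / 2\<close> turns the value at \<open>- \<tau>\<close> into \<open>P (- s)\<close>. With \<open>F s = (s - a) * G s\<close>
  the closed-loop equation gives \<open>s\<^sup>2 * G s * G (- s) = 1 - F s - F (- s)\<close>, so on the imaginary axis
  \<open>\<bar>G\<bar>\<^sup>2\<close> is linear in \<open>F\<close>. As \<open>F\<close> is bounded and holomorphic in the closed right half-plane with
  \<open>F 0 = 1 / 2\<close>, Cauchy's theorem yields \<open>\<parallel>G\<parallel>\<^sup>2 = F' 0 = (a \<tau> - 1) / (4 a)\<close>, which does not depend on \<open>P\<close>.
\<close>

subsection \<open>The norm of the closed loop\<close>

lemma has_bochner_integral_inverse_1_plus_square:
  "has_bochner_integral lborel (\<lambda>x::real. inverse (1 + x\<^sup>2)) pi"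
proof -
  have "integrable lborel (\<lambda>x::real. inverse (1 + x\<^sup>2))"
    using integrable_inverse_1_plus_square by (simp add: set_integrable_def)
  moreover have "(LBINT x::real. inverse (1 + x\<^sup>2)) = pi"
    using LBINT_inverse_1_plus_square
    by (simp add: interval_lebesgue_integral_def set_lebesgue_integral_def)
  ultimately show ?thesis
    by (simp add: has_bochner_integral_iff)
qed

text \<open>Cauchy's theorem on a right half-disc of radius \<open>\<rho>\<close>: the arc
  contributes at most \<open>C * pi / \<rho>\<close>, so the integral over the diameter tends to 0.
  Quadratic decay also gives absolute integrability, so these truncated integrals converge to the
  full one.\<close>

lemma has_bochner_integral_imaginary_axis_0:
  fixes K :: "complex \<Rightarrow> complex"
  assumes holo: "K holomorphic_on {s. 0 \<le> Re s}"
    and bound: "\<And>s. 0 \<le> Re s \<Longrightarrow> R \<le> cmod s \<Longrightarrow> cmod (K s) \<le> C / (cmod s)\<^sup>2"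
  shows "has_bochner_integral lborel (\<lambda>\<omega>. K (\<i> * of_real \<omega>)) 0"
proof -
  define f where "f \<omega> = K (\<i> * of_real \<omega>)" for \<omega> :: real
  define r where "r = max R 1"
  have r: "r \<ge> 1" "r \<ge> R"
    by (auto simp: r_def)
  have cont: "continuous_on A f" for A
    unfolding f_def
    by (rule continuous_on_compose2[OF holomorphic_on_imp_continuous_on[OF holo]])
       (auto intro!: continuous_intros)
  have f_meas [measurable]: "f \<in> borel_measurable borel"
    using cont by (rule borel_measurable_continuous_onI)
  have f_bound: "cmod (f \<omega>) \<le> C / \<omega>\<^sup>2" if "\<bar>\<omega>\<bar> \<ge> r" for \<omega>
    using bound[of "\<i> * of_real \<omega>"] that r by (simp add: f_def norm_mult)
  have "0 \<le> C / r\<^sup>2"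
    using f_bound[of r] norm_ge_zero[of "f r"] r by linarith
  then have "C \<ge> 0"
    using r by (simp add: zero_le_divide_iff)
  obtain B where B: "\<And>\<omega>. \<omega> \<in> {-r..r} \<Longrightarrow> cmod (f \<omega>) \<le> B"
  proof -
    have "bounded (f ` {-r..r})"
      by (intro compact_imp_bounded compact_continuous_image cont) auto
    then show ?thesis
      using that unfolding bounded_iff by blast
  qed
  have "B \<ge> 0"
    using B[of 0] norm_ge_zero[of "f 0"] r by (smt (verit) atLeastAtMost_iff)
  \<comment> \<open>The first summand covers \<open>\<bar>\<omega>\<bar> \<le> r\<close>; the second
    uses \<open>1 + \<omega>\<^sup>2 \<le> 2 * \<omega>\<^sup>2\<close> beyond it.\<close>
  define D where "D = B * (1 + r\<^sup>2) + 2 * C"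
  have dom: "norm (f \<omega>) \<le> norm (D * inverse (1 + \<omega>\<^sup>2))" for \<omega>
  proof -
    have pos: "1 + \<omega>\<^sup>2 > 0"
      by (simp add: add_pos_nonneg)
    have "norm (f \<omega>) * (1 + \<omega>\<^sup>2) \<le> D"
    proof (cases "\<bar>\<omega>\<bar> \<le> r")
      case True
      have "norm (f \<omega>) * (1 + \<omega>\<^sup>2) \<le> B * (1 + r\<^sup>2)"
        using B[of \<omega>] True \<open>B \<ge> 0\<close> r by (intro mult_mono) (auto simp: abs_le_iff abs_le_square_iff[symmetric])
      then show ?thesis
        using \<open>C \<ge> 0\<close> by (simp add: D_def)
    next
      case False
      then have "\<bar>\<omega>\<bar> \<ge> 1" using r by linarith
      then have \<omega>: "\<omega>\<^sup>2 \<ge> 1"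
        using abs_le_square_iff[of 1 \<omega>] by simp
      have "norm (f \<omega>) * (1 + \<omega>\<^sup>2) \<le> C / \<omega>\<^sup>2 * (2 * \<omega>\<^sup>2)"
        using f_bound[of \<omega>] False \<omega> \<open>C \<ge> 0\<close> by (intro mult_mono) auto
      also have "\<dots> = 2 * C"
        using \<omega> by (auto simp: field_simps)
      finally show ?thesis
        using \<open>B \<ge> 0\<close> mult_nonneg_nonneg[of B "1 + r\<^sup>2"] unfolding D_def by (smt (verit) zero_le_power2)
    qed
    then have "norm (f \<omega>) \<le> D * inverse (1 + \<omega>\<^sup>2)"
      using pos by (simp add: field_simps)
    then show ?thesis
      by (smt (verit) real_norm_def)
  qed
  have int: "integrable lborel f"
    using has_bochner_integral_inverse_1_plus_square dom
    by (intro Bochner_Integration.integrable_bound[of lborel "\<lambda>\<omega>. D * inverse (1 + \<omega>\<^sup>2)" f])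
       (auto simp: has_bochner_integral_iff)
  have trunc: "cmod (LBINT x:{-\<rho>..\<rho>}. f x) \<le> C * pi / \<rho>" if "\<rho> \<ge> r" for \<rho>
  proof -
    define z where "z = \<i> * complex_of_real \<rho>"
    define arc where "arc = part_circlepath 0 \<rho> (-(pi/2)) (pi/2)"
    have "\<rho> > 0" using that r by linarith
    have ends: "pathstart arc = -z" "pathfinish arc = z"
      unfolding arc_def z_def pathstart_part_circlepath pathfinish_part_circlepath cis_conv_exp[symmetric]
      by (simp_all add: complex_eq_iff)
    have valid [simp]: "valid_path arc"
      by (simp add: arc_def)
    have arc_subset: "path_image arc \<subseteq> {s. 0 \<le> Re s}"
    proof -
      have "closed_segment (-(pi/2)) (pi/2) = {-(pi/2)..pi/2}"
        by (simp add: closed_segment_eq_real_ivl)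
      then show ?thesis
        using \<open>\<rho> > 0\<close> cos_ge_zero by (auto simp: arc_def path_image_part_circlepath')
    qed
    have line_subset: "path_image (linepath z (-z)) \<subseteq> {s. 0 \<le> Re s}"
    proof -
      have "z \<in> {s. 0 \<le> Re s}" "-z \<in> {s. 0 \<le> Re s}" by (auto simp: z_def)
      then show ?thesis
        unfolding path_image_linepath by (intro closed_segment_subset convex_halfspace_Re_ge)
    qed
    have Kc: "continuous_on {s. 0 \<le> Re s} K"
      using holo by (rule holomorphic_on_imp_continuous_on)
    have arc_int: "K contour_integrable_on arc"
      using continuous_on_subset[OF Kc arc_subset] unfolding arc_def
      by (rule contour_integrable_continuous_part_circlepath)
    have line_int: "K contour_integrable_on linepath z (-z)"
      using continuous_on_subset[OF Kc line_subset]
      by (intro contour_integrable_continuous_linepath) simp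
    \<comment> \<open>The contour runs down the axis and back along the arc. Holomorphy on the
      closed half-plane suffices, since this form of Cauchy's theorem asks for a convex set, not an
      open one.\<close>
    have "(K has_contour_integral 0) (linepath z (-z) +++ arc)"
    proof (rule Cauchy_theorem_convex_simple[OF holo convex_halfspace_Re_ge])
      show "path_image (linepath z (-z) +++ arc) \<subseteq> {s. 0 \<le> Re s}"
        using line_subset arc_subset by (intro subset_path_image_join) auto
    qed (auto simp: ends)
    then have "contour_integral (linepath z (-z)) K + contour_integral arc K = 0"
      using line_int arc_int by (metis contour_integral_join contour_integral_unique valid valid_path_linepath)
    then have "contour_integral arc K = contour_integral (linepath (-z) z) K"
      using Kc line_subset by (subst contour_integral_reverse_linepath)
        (auto intro: continuous_on_subset simp: closed_segment_commute add_eq_0_iff)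
    also have "\<dots> = \<i> * integral {-\<rho>..\<rho>} (\<lambda>x. K (Complex 0 x))"
      using \<open>\<rho> > 0\<close> by (intro contour_integral_linepath_same_Re) (auto simp: z_def)
    also have "(\<lambda>x. K (Complex 0 x)) = f"
      by (auto simp: f_def fun_eq_iff Complex_eq)
    also have "integral {-\<rho>..\<rho>} f = (LBINT x:{-\<rho>..\<rho>}. f x)"
      by (rule set_borel_integral_eq_integral(2)[symmetric])
         (intro borel_integrable_atLeastAtMost' cont)
    finally have "cmod (LBINT x:{-\<rho>..\<rho>}. f x) = cmod (contour_integral arc K)"
      by (simp add: norm_mult)
    also have "\<dots> \<le> C / \<rho>\<^sup>2 * \<rho> * \<bar>pi/2 - (-(pi/2))\<bar>"
      unfolding arc_def
    proof (rule contour_integral_bound_part_circlepath)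
      fix s assume "s \<in> path_image (part_circlepath 0 \<rho> (- (pi / 2)) (pi / 2))"
      then have "cmod s = \<rho>" "0 \<le> Re s"
        using in_path_image_part_circlepath[of s 0 \<rho> "-(pi/2)" "pi/2"] arc_subset \<open>\<rho> > 0\<close>
        by (auto simp: arc_def)
      then show "cmod (K s) \<le> C / \<rho>\<^sup>2"
        using bound[of s] that r by simp
    qed (use arc_int \<open>C \<ge> 0\<close> \<open>\<rho> > 0\<close> in \<open>auto simp: arc_def\<close>)
    also have "\<dots> = C * pi / \<rho>"
      using \<open>\<rho> > 0\<close> by (simp add: power2_eq_square)
    finally show ?thesis .
  qed
  have lim: "(\<lambda>n. LBINT x:{-real n..real n}. f x) \<longlonglongrightarrow> integral\<^sup>L lborel f"
    unfolding set_lebesgue_integral_def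
  proof (rule integral_dominated_convergence[where w = "\<lambda>x. norm (f x)"])
    show "AE x in lborel. (\<lambda>n. indicat_real {-real n..real n} x *\<^sub>R f x) \<longlonglongrightarrow> f x"
    proof (rule AE_I2)
      fix x :: real
      obtain m where m: "\<bar>x\<bar> \<le> real m"
        using real_arch_simple by blast
      have "\<forall>\<^sub>F n in sequentially. indicat_real {-real n..real n} x *\<^sub>R f x = f x"
        using eventually_ge_at_top[of m] by eventually_elim (use m in \<open>auto simp: indicator_def\<close>)
      then show "(\<lambda>n. indicat_real {-real n..real n} x *\<^sub>R f x) \<longlonglongrightarrow> f x"
        by (rule tendsto_eventually)
    qed
  qed (use int in \<open>auto split: split_indicator\<close>)
  have "(\<lambda>n. LBINT x:{-real n..real n}. f x) \<longlonglongrightarrow> 0"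
  proof (rule Lim_null_comparison)
    show "\<forall>\<^sub>F n in sequentially. norm (LBINT x:{-real n..real n}. f x) \<le> C * pi / real n"
      using eventually_ge_at_top[of "nat \<lceil>r\<rceil>"] by eventually_elim (intro trunc, linarith)
    show "(\<lambda>n. C * pi / real n) \<longlonglongrightarrow> 0"
      by (rule lim_const_over_n)
  qed
  with lim have "integral\<^sup>L lborel f = 0"
    using LIMSEQ_unique by blast
  with int show ?thesis
    unfolding f_def by (simp add: has_bochner_integral_iff)
qed

section \<open>Squared modulus and norm of a closed loop\<close>

text \<open>Read \<open>p\<close> as \<open>P s\<close>, \<open>q\<close> as \<open>P (- s)\<close>
  and \<open>A\<close> as the denominator at \<open>s\<close>. Then \<open>cnj A\<close> is
  \<open>u\<close> times the denominator at \<open>- s\<close>, and \<open>u\<close> cancels from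
  the squared modulus. \<open>D\<close> is arbitrary: its rational term is compensated by
  \<open>2 * D * inverse (1 + \<omega>\<^sup>2)\<close>.\<close>

lemma cmod_square_closed_loop:
  fixes s p q u :: complex and a D \<omega> :: real
  defines "A \<equiv> (s - of_real a) * p - of_real a * q"
  assumes s: "s = \<i> * of_real \<omega>" "\<omega> \<noteq> 0" and "A \<noteq> 0"
    and cnj: "cnj p = u * q" "cnj q = u * p" and "u \<noteq> 0"
  shows "(cmod (p / A))\<^sup>2 = 2 * D * inverse (1 + \<omega>\<^sup>2)
    - 2 * Re (((s - of_real a) * p / A - 1 / 2 - of_real D * s / (1 + s)) / s\<^sup>2)"
proof -
  define F where "F = (s - of_real a) * p / A"
  define B where "B = (- s - of_real a) * q - of_real a * p"
  have [simp]: "cnj s = - s" "s \<noteq> 0"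
    using s by auto
  have cnj_A: "cnj A = u * B"
    by (simp add: A_def B_def cnj algebra_simps)
  have "B \<noteq> 0"
    using cnj_A \<open>A \<noteq> 0\<close> by auto
  have cnj_F: "cnj F = (- s - of_real a) * q / B"
    using \<open>u \<noteq> 0\<close> by (simp add: F_def cnj_A cnj)
  have s2: "s\<^sup>2 = - (of_real (\<omega>\<^sup>2))"
    by (simp add: s power_mult_distrib)
  have nz: "1 + s \<noteq> 0" "1 - s \<noteq> 0" "1 + (of_real \<omega>)\<^sup>2 \<noteq> (0 :: complex)"
  proof -
    show "1 + s \<noteq> 0" "1 - s \<noteq> 0"
      by (auto simp: s complex_eq_iff)
    have "1 + \<omega>\<^sup>2 \<noteq> 0"
      by (simp add: add_nonneg_eq_0_iff)
    then show "1 + (of_real \<omega>)\<^sup>2 \<noteq> (0 :: complex)"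
      by (metis of_real_1 of_real_add of_real_eq_0_iff of_real_power)
  qed
  have "of_real ((cmod (p / A))\<^sup>2) = p / A * cnj (p / A)"
    by (rule complex_norm_square)
  also have "\<dots> = p * q / (A * B)"
    using \<open>u \<noteq> 0\<close> by (simp add: cnj_A cnj)
  also have "\<dots> = (1 - F - cnj F) / s\<^sup>2"
  proof -
    \<comment> \<open>With \<open>\<alpha> = (s - a) * p\<close> and
      \<open>\<beta> = (- s - a) * q\<close>, the right-hand side is
      \<open>(A - \<alpha>) * (B - \<beta>) - \<alpha> * \<beta>\<close>, where
      \<open>(A - \<alpha>) * (B - \<beta>) = a\<^sup>2 * p * q\<close>.\<close>
    have "s\<^sup>2 * (p * q) = A * B - (s - of_real a) * p * B - (- s - of_real a) * q * A"
      unfolding A_def B_def by (simp add: algebra_simps power2_eq_square)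
    also have "\<dots> = (A * B) * (1 - F - cnj F)"
      using \<open>A \<noteq> 0\<close> \<open>B \<noteq> 0\<close> unfolding cnj_F by (simp add: F_def field_simps)
    finally show ?thesis
      using \<open>A \<noteq> 0\<close> \<open>B \<noteq> 0\<close> by (simp add: field_simps)
  qed
  finally have *: "of_real ((cmod (p / A))\<^sup>2) = (1 - F - cnj F) / s\<^sup>2" .
  have "of_real D * s / (1 + s) + cnj (of_real D * s / (1 + s)) = of_real D * (s / (1 + s) - s / (1 - s))"
    by (simp add: algebra_simps)
  also have "s / (1 + s) - s / (1 - s) = - 2 * s\<^sup>2 / ((1 + s) * (1 - s))"
    using nz by (simp add: field_simps power2_eq_square)
  also have "(1 + s) * (1 - s) = 1 + (of_real \<omega>)\<^sup>2"
    using s2 by (simp add: algebra_simps power2_eq_square)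
  finally have **: "of_real D * s / (1 + s) + cnj (of_real D * s / (1 + s)) =
      - 2 * of_real D * s\<^sup>2 / (1 + (of_real \<omega>)\<^sup>2)"
    by simp
  have "of_real (2 * Re ((F - 1 / 2 - of_real D * s / (1 + s)) / s\<^sup>2)) =
      (F - 1 / 2 - of_real D * s / (1 + s)) / s\<^sup>2 + cnj ((F - 1 / 2 - of_real D * s / (1 + s)) / s\<^sup>2)"
    by (rule complex_add_cnj[symmetric])
  also have "\<dots> = (F + cnj F - 1 - (of_real D * s / (1 + s) + cnj (of_real D * s / (1 + s)))) / s\<^sup>2"
    by (simp add: diff_divide_distrib add_divide_distrib)
  also have "\<dots> = (F + cnj F - 1) / s\<^sup>2 + 2 * of_real D / (1 + (of_real \<omega>)\<^sup>2)"
    unfolding ** using nz by (simp add: diff_divide_distrib add_divide_distrib)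
  finally have "complex_of_real (2 * Re ((F - 1 / 2 - of_real D * s / (1 + s)) / s\<^sup>2)) =
      of_real (2 * D * inverse (1 + \<omega>\<^sup>2) - (cmod (p / A))\<^sup>2)"
    unfolding of_real_diff * by (simp add: field_simps)
  then show ?thesis
    unfolding of_real_eq_iff F_def by linarith
qed

text \<open>The factor \<open>u\<close> allows for a constant complex multiple in \<open>P\<close>.
  The growth bound keeps \<open>d s\<close> comparable to \<open>s * P s\<close> far out, so
  \<open>F\<close> is bounded there. The value depends on \<open>P\<close> only through the ratio
  \<open>P' 0 / P 0\<close>, which is fixed as \<open>\<tau> / 2\<close>.\<close>

lemma H2_norm_closed_loop:
  fixes P H :: "complex \<Rightarrow> complex" and a \<tau> :: real
  defines "d \<equiv> (\<lambda>s. (s - of_real a) * P s - of_real a * P (- s))"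
  assumes a: "a \<noteq> 0"
    and holo: "P holomorphic_on UNIV"
    and cnj: "\<And>\<omega>::real. cnj (P (\<i> * of_real \<omega>)) = u * P (- (\<i> * of_real \<omega>))"
    and P0: "P 0 \<noteq> 0" "(P has_field_derivative of_real (\<tau> / 2) * P 0) (at 0)"
    and nz: "\<And>s. 0 \<le> Re s \<Longrightarrow> d s \<noteq> 0"
    and bound: "\<And>s. 0 \<le> Re s \<Longrightarrow> R \<le> cmod s \<Longrightarrow> cmod (P (- s)) \<le> M * cmod (P s)"
    and H: "\<And>s. 0 \<le> Re s \<Longrightarrow> H s = P s / d s"
  shows "H2_finite H \<and> H2_norm H = sqrt ((a * \<tau> - 1) / (4 * a))"
proof -
  \<comment> \<open>This is the derivative of \<open>F\<close> at 0, as the quotient rule shows in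
    \<open>deriv_f0\<close>.\<close>
  define D where "D = (a * \<tau> - 1) / (4 * a)"
  define F where "F s = (s - of_real a) * P s / d s" for s
  \<comment> \<open>Subtracting \<open>D * s / (1 + s)\<close> removes the simple pole that \<open>(F s - 1 / 2) / s\<^sup>2\<close> has at \<open>0\<close>.\<close>
  define f where "f s = F s - 1 / 2 - of_real D * s / (1 + s)" for s
  \<comment> \<open>An open set around the closed half-plane: removing the singularity at 0, which
    lies on the boundary of the half-plane, needs a full neighbourhood.\<close>
  define U where "U = {s. d s \<noteq> 0} \<inter> {s. 1 + s \<noteq> 0}"
  have P_minus: "(\<lambda>s. P (- s)) holomorphic_on A" for A
    using holomorphic_on_compose_gen[OF holomorphic_on_minus[OF holomorphic_on_ident] holo]
    by (auto simp: o_def intro: holomorphic_on_subset)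
  have P_holo: "P holomorphic_on A" for A
    using holo by (rule holomorphic_on_subset) simp
  have d_holo: "d holomorphic_on A" for A
    unfolding d_def by (intro holomorphic_intros P_minus P_holo)
  have "open U"
    unfolding U_def
    by (intro open_Int open_Collect_neq continuous_intros holomorphic_on_imp_continuous_on[OF d_holo])
  have f_holo: "f holomorphic_on U"
    unfolding f_def F_def by (intro holomorphic_intros P_holo d_holo) (auto simp: U_def)
  have half_plane: "{s. 0 \<le> Re s} \<subseteq> U"
    using nz by (auto simp: U_def complex_eq_iff)
  have d0: "d 0 = - 2 * of_real a * P 0"
    by (simp add: d_def)
  have f0: "f 0 = 0"
    using a P0 by (simp add: f_def F_def d0)
  have deriv_f0: "(f has_field_derivative 0) (at 0)"
  proof -
    have neg: "((\<lambda>s. P (- s)) has_field_derivative - (of_real (\<tau> / 2) * P 0)) (at 0)"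
    proof -
      have "((\<lambda>s. P (- s)) has_field_derivative of_real (\<tau> / 2) * P 0 * - 1) (at 0)"
      proof (rule DERIV_chain2[where f = P and g = uminus])
        show "(P has_field_derivative of_real (\<tau> / 2) * P 0) (at (- 0))"
          using P0 by simp
      qed (auto intro!: derivative_eq_intros)
      then show ?thesis by simp
    qed
    have d': "(d has_field_derivative P 0) (at 0)"
      unfolding d_def by (rule derivative_eq_intros neg P0(2) refl)+ (simp add: algebra_simps)
    have n': "((\<lambda>s. (s - of_real a) * P s) has_field_derivative
        P 0 - of_real a * (of_real (\<tau> / 2) * P 0)) (at 0)"
      by (rule derivative_eq_intros P0(2) refl)+ (simp add: algebra_simps)
    have "(F has_field_derivative
        ((P 0 - of_real a * (of_real (\<tau> / 2) * P 0)) * d 0 - (0 - of_real a) * P 0 * P 0) / (d 0 * d 0)) (at 0)"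
      unfolding F_def using a P0 by (intro DERIV_divide n' d') (auto simp: d0)
    also have "((P 0 - of_real a * (of_real (\<tau> / 2) * P 0)) * d 0 - (0 - of_real a) * P 0 * P 0) / (d 0 * d 0)
        = of_real D"
      using a P0 unfolding d0 by (simp add: D_def field_simps power2_eq_square)
    finally have F': "(F has_field_derivative of_real D) (at 0)" .
    have D': "((\<lambda>s. of_real D * s / (1 + s)) has_field_derivative of_real D) (at 0)"
      by (auto intro!: derivative_eq_intros)
    show ?thesis
      using DERIV_diff[OF DERIV_diff[OF F' DERIV_const] D'] unfolding f_def by simp
  qed
  \<comment> \<open>Two divisions by \<open>s\<close>, each filled in at 0 by a derivative. Since
    \<open>f\<close> and its derivative vanish at 0, the result is \<open>f s / s\<^sup>2\<close>
    elsewhere.\<close>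
  define K1 where "K1 s = (if s = 0 then deriv f 0 else (f s - f 0) / (s - 0))" for s
  define K where "K s = (if s = 0 then deriv K1 0 else (K1 s - K1 0) / (s - 0))" for s
  have "K1 holomorphic_on U"
    unfolding K1_def using f_holo \<open>open U\<close> by (rule pole_lemma_open)
  then have "K holomorphic_on U"
    unfolding K_def using \<open>open U\<close> by (rule pole_lemma_open)
  then have K_holo: "K holomorphic_on {s. 0 \<le> Re s}"
    using half_plane by (rule holomorphic_on_subset)
  have "K1 0 = 0"
    using deriv_f0 by (simp add: K1_def DERIV_imp_deriv)
  then have K_eq: "K s = f s / s\<^sup>2" if "s \<noteq> 0" for s
    using that f0 by (simp add: K_def K1_def power2_eq_square)
  \<comment> \<open>The last entry gives
    \<open>\<bar>a\<bar> * (1 + \<bar>M\<bar>) \<le> cmod s / 2\<close>, so that \<open>d s\<close>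
    keeps at least half the modulus of \<open>s * P s\<close>.\<close>
  define r where "r = max (max R 1) (2 * \<bar>a\<bar> * (1 + \<bar>M\<bar>))"
  \<comment> \<open>The three summands bound \<open>F s\<close>, \<open>1 / 2\<close> and
    \<open>D * s / (1 + s)\<close>.\<close>
  have K_bound: "cmod (K s) \<le> (2 * (1 + \<bar>a\<bar>) + 1 / 2 + \<bar>D\<bar>) / (cmod s)\<^sup>2"
    if s: "0 \<le> Re s" "r \<le> cmod s" for s
  proof -
    have r: "R \<le> cmod s" "1 \<le> cmod s" "2 * \<bar>a\<bar> * (1 + \<bar>M\<bar>) \<le> cmod s"
      using s by (auto simp: r_def)
    have Pm: "cmod (P (- s)) \<le> \<bar>M\<bar> * cmod (P s)"
      using bound[OF s(1) r(1)] by (rule order.trans) (simp add: mult_right_mono)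
    have "P s \<noteq> 0"
      using nz[OF s(1)] Pm by (auto simp: d_def)
    have "cmod s * cmod (P s) - \<bar>a\<bar> * (1 + \<bar>M\<bar>) * cmod (P s) \<le> cmod (d s)"
    proof -
      have "s * P s = d s + of_real a * P s + of_real a * P (- s)"
        by (simp add: d_def algebra_simps)
      then have "cmod s * cmod (P s) = cmod (d s + of_real a * P s + of_real a * P (- s))"
        by (simp flip: norm_mult)
      also have "\<dots> \<le> cmod (d s) + cmod (of_real a * P s) + cmod (of_real a * P (- s))"
        by (intro order.trans[OF norm_triangle_ineq] add_right_mono norm_triangle_ineq)
      also have "\<dots> = cmod (d s) + \<bar>a\<bar> * cmod (P s) + \<bar>a\<bar> * cmod (P (- s))"
        by (simp add: norm_mult)
      also have "\<dots> \<le> cmod (d s) + \<bar>a\<bar> * cmod (P s) + \<bar>a\<bar> * (\<bar>M\<bar> * cmod (P s))"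
        using Pm by (intro add_left_mono mult_left_mono) auto
      finally show ?thesis
        by (simp add: algebra_simps)
    qed
    moreover have "\<bar>a\<bar> * (1 + \<bar>M\<bar>) * cmod (P s) \<le> cmod s / 2 * cmod (P s)"
      using r(3) by (intro mult_right_mono) auto
    ultimately have d_ge: "cmod s / 2 * cmod (P s) \<le> cmod (d s)"
      by (simp add: field_simps)
    have "cmod (F s) \<le> 2 * (1 + \<bar>a\<bar>)"
    proof -
      have "cmod (s - of_real a) \<le> cmod s + \<bar>a\<bar> * 1"
        using norm_triangle_ineq4[of s "of_real a"] by simp
      also have "\<dots> \<le> cmod s + \<bar>a\<bar> * cmod s"
        using r(2) by (intro add_left_mono mult_left_mono) auto
      finally have "cmod (s - of_real a) * cmod (P s) \<le> (cmod s + \<bar>a\<bar> * cmod s) * cmod (P s)"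
        by (rule mult_right_mono) simp
      also have "\<dots> = 2 * (1 + \<bar>a\<bar>) * (cmod s / 2 * cmod (P s))"
        by (simp add: algebra_simps)
      also have "\<dots> \<le> 2 * (1 + \<bar>a\<bar>) * cmod (d s)"
        using d_ge by (rule mult_left_mono) simp
      finally show ?thesis
        using nz[OF s(1)] by (simp add: F_def norm_mult norm_divide pos_divide_le_eq)
    qed
    moreover have "cmod (of_real D * s / (1 + s)) \<le> \<bar>D\<bar>"
    proof -
      have "cmod s \<le> cmod (1 + s)"
        using s(1) unfolding cmod_def by (intro real_sqrt_le_mono add_mono) (auto intro!: power_mono)
      then have "\<bar>D\<bar> * cmod s \<le> \<bar>D\<bar> * cmod (1 + s)"
        by (rule mult_left_mono) simp
      moreover have "1 + s \<noteq> 0"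
        using s(1) by (auto simp: complex_eq_iff)
      ultimately show ?thesis
        by (simp add: norm_mult norm_divide field_simps)
    qed
    ultimately have "cmod (f s) \<le> 2 * (1 + \<bar>a\<bar>) + 1 / 2 + \<bar>D\<bar>"
      unfolding f_def
      using norm_triangle_ineq4[of "F s - 1 / 2" "of_real D * s / (1 + s)"] norm_triangle_ineq4[of "F s" "1 / 2"]
      by simp
    moreover have "s \<noteq> 0" using r(2) by auto
    ultimately show ?thesis
      by (simp add: K_eq norm_divide norm_power divide_right_mono)
  qed
  have int_K: "has_bochner_integral lborel (\<lambda>\<omega>. K (\<i> * of_real \<omega>)) 0"
    using K_holo K_bound by (rule has_bochner_integral_imaginary_axis_0)
  have "has_bochner_integral lborel
      (\<lambda>\<omega>. 2 * D * inverse (1 + \<omega>\<^sup>2) - 2 * Re (K (\<i> * of_real \<omega>))) (2 * D * pi - 2 * Re 0)"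
    by (intro has_bochner_integral_diff has_bochner_integral_mult_right has_bochner_integral_Re int_K
        has_bochner_integral_inverse_1_plus_square)
  then have int: "has_bochner_integral lborel
      (\<lambda>\<omega>. 2 * D * inverse (1 + \<omega>\<^sup>2) - 2 * Re (K (\<i> * of_real \<omega>))) (2 * D * pi)"
    by simp
  have u: "u \<noteq> 0"
    using cnj[of 0] P0 by auto
  have eq: "(cmod (H (\<i> * of_real \<omega>)))\<^sup>2 = 2 * D * inverse (1 + \<omega>\<^sup>2) - 2 * Re (K (\<i> * of_real \<omega>))"
    if "\<omega> \<noteq> 0" for \<omega>
  proof -
    have "d (\<i> * of_real \<omega>) \<noteq> 0"
      by (rule nz) simp
    moreover have "cnj (P (- (\<i> * of_real \<omega>))) = u * P (\<i> * of_real \<omega>)"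
      using cnj[of "- \<omega>"] by simp
    ultimately show ?thesis
      using cmod_square_closed_loop[of "\<i> * of_real \<omega>" \<omega> a "P (\<i> * of_real \<omega>)" "P (- (\<i> * of_real \<omega>))" u D]
        that u cnj[of \<omega>] by (simp add: H K_eq f_def F_def d_def)
  qed
  have meas: "(\<lambda>\<omega>. (cmod (H (\<i> * of_real \<omega>)))\<^sup>2) \<in> borel_measurable lborel"
  proof -
    have "continuous_on UNIV (\<lambda>\<omega>. (cmod (P (\<i> * of_real \<omega>) / d (\<i> * of_real \<omega>)))\<^sup>2)"
      using nz by (intro continuous_intros continuous_on_compose2[OF holomorphic_on_imp_continuous_on[OF holo]]
          continuous_on_compose2[OF holomorphic_on_imp_continuous_on[OF d_holo[of UNIV]]]) auto
    then show ?thesis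
      by (simp add: H borel_measurable_continuous_onI)
  qed
  \<comment> \<open>The formula for the squared modulus divides by \<open>s\<^sup>2\<close>, so the
    null set at 0 is left out.\<close>
  have "AE \<omega> in lborel. \<omega> \<noteq> (0::real)"
    by (rule AE_lborel_singleton)
  then have "AE \<omega> in lborel. 2 * D * inverse (1 + \<omega>\<^sup>2) - 2 * Re (K (\<i> * of_real \<omega>)) = (cmod (H (\<i> * of_real \<omega>)))\<^sup>2"
    by eventually_elim (simp add: eq)
  then have "has_bochner_integral lborel (\<lambda>\<omega>. (cmod (H (\<i> * of_real \<omega>)))\<^sup>2) (2 * D * pi)"
    by (rule has_bochner_integral_cong_AE[THEN iffD1, OF borel_measurable_has_bochner_integral[OF int] meas _ int])
  then have "integrable lebesgue (\<lambda>\<omega>. (cmod (H (\<i> * of_real \<omega>)))\<^sup>2)"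
    and "integral\<^sup>L lebesgue (\<lambda>\<omega>. (cmod (H (\<i> * of_real \<omega>)))\<^sup>2) = 2 * D * pi"
    using meas by (auto simp: has_bochner_integral_iff integrable_completion integral_completion)
  then show ?thesis
    by (simp add: H2_finite_def H2_norm_def flip: D_def)
qed

section \<open>The delay system\<close>

text \<open>Multiplying numerator and denominator by \<open>exp (\<tau> * s / 2)\<close> splits the
  delay evenly between \<open>P s\<close> and \<open>P (- s)\<close>.\<close>

lemma delay_transfer_H2:
  assumes a: "a < 0" and \<tau>: "\<tau> > 0"
  shows "H2_finite (delay_transfer a \<tau>) \<and>
    H2_norm (delay_transfer a \<tau>) = sqrt ((a * \<tau> - 1) / (4 * a))"
proof -
  define P where "P s = exp (of_real (\<tau> / 2) * s)" for s :: complex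
  have eq: "(s - of_real a) * P s - of_real a * P (- s) =
      P s * (s - of_real a * (1 + exp (- of_real \<tau> * s)))" for s
  proof -
    have "P (- s) = P s * exp (- of_real \<tau> * s)"
      unfolding P_def exp_add[symmetric] by (simp add: field_simps)
    then show ?thesis
      by (simp add: algebra_simps)
  qed
  \<comment> \<open>A zero satisfies \<open>s = a * (1 + z)\<close> with
    \<open>cmod z \<le> 1\<close>. As \<open>a < 0\<close>, the condition
    \<open>0 \<le> Re s\<close> forces \<open>Re z = -1\<close>, hence \<open>z = -1\<close> and
    \<open>s = 0\<close>; but \<open>s = 0\<close> gives \<open>z = 1\<close>.\<close>
  have nz: "s - of_real a * (1 + exp (- of_real \<tau> * s)) \<noteq> 0" if "0 \<le> Re s" for s
  proof
    define z where "z = exp (- of_real \<tau> * s)"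
    assume "s - of_real a * (1 + exp (- of_real \<tau> * s)) = 0"
    then have s: "s = of_real a * (1 + z)"
      by (simp add: z_def)
    have z: "cmod z \<le> 1"
      using that \<tau> by (simp add: z_def)
    have "1 + Re z \<ge> 0"
      using z abs_Re_le_cmod[of z] by linarith
    moreover have "a * (1 + Re z) \<ge> 0"
      using that unfolding s by simp
    ultimately have Re: "Re z = -1"
      using a by (smt (verit) mult_neg_pos)
    have "(cmod z)\<^sup>2 \<le> 1"
      using z by (simp add: power_le_one)
    then have "Im z = 0"
      unfolding cmod_power2 by (simp add: Re)
    with Re have "z = -1"
      by (simp add: complex_eq_iff)
    then have "s = 0" by (simp add: s)
    then show False
      using \<open>z = -1\<close> by (simp add: z_def)
  qed
  have "P holomorphic_on UNIV"
    unfolding P_def by (intro holomorphic_intros)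
  moreover have "cnj (P (\<i> * of_real \<omega>)) = 1 * P (- (\<i> * of_real \<omega>))" for \<omega> :: real
    by (simp add: P_def exp_cnj)
  moreover have "(P has_field_derivative of_real (\<tau> / 2) * P 0) (at 0)"
    unfolding P_def by (auto intro!: derivative_eq_intros)
  moreover have "cmod (P (- s)) \<le> 1 * cmod (P s)" if "0 \<le> Re s" for s
    using that \<tau> by (simp add: P_def)
  moreover have "(s - of_real a) * P s - of_real a * P (- s) \<noteq> 0" if "0 \<le> Re s" for s
    using nz[OF that] unfolding eq by (simp add: P_def)
  moreover have "delay_transfer a \<tau> s = P s / ((s - of_real a) * P s - of_real a * P (- s))" for s
    unfolding eq by (simp add: delay_transfer_def P_def inverse_eq_divide)
  ultimately show ?thesis
    using a by (intro H2_norm_closed_loop[where P = P and u = 1 and R = 0 and M = 1]) (auto simp: P_def)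
qed

subsection \<open>Orthogonal polynomials\<close>

text \<open>Polynomials are bounded on the compact interval, so a multiple of the weight
  dominates.\<close>

lemma set_integrable_poly_inner:
  assumes "weight_on \<tau> w"
  shows "set_integrable lebesgue {-\<tau>..0}
    (\<lambda>\<theta>. poly f (of_real \<theta>) * cnj (poly g (of_real \<theta>)) * of_real (w \<theta>))"
proof -
  define h where "h \<theta> = poly f (of_real \<theta>) * cnj (poly g (of_real \<theta>))" for \<theta> :: real
  have cont: "continuous_on A h" for A
    unfolding h_def by (intro continuous_intros)
  then have h_meas: "h \<in> borel_measurable lebesgue"
    by (intro measurable_completion) (simp add: borel_measurable_continuous_onI)
  have w: "integrable lebesgue (\<lambda>\<theta>. indicator {-\<tau>..0} \<theta> *\<^sub>R w \<theta>)"
    using assms by (simp add: weight_on_def set_integrable_def)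
  have "bounded (h ` {-\<tau>..0})"
    by (intro compact_imp_bounded compact_continuous_image cont) auto
  then obtain C where C: "\<And>\<theta>. \<theta> \<in> {-\<tau>..0} \<Longrightarrow> cmod (h \<theta>) \<le> C"
    unfolding bounded_iff by blast
  have "integrable lebesgue (\<lambda>\<theta>. h \<theta> * of_real (indicator {-\<tau>..0} \<theta> *\<^sub>R w \<theta>))"
  proof (rule Bochner_Integration.integrable_bound)
    show "integrable lebesgue (\<lambda>\<theta>. C * (indicator {-\<tau>..0} \<theta> *\<^sub>R w \<theta>))"
      using w by simp
    show "(\<lambda>\<theta>. h \<theta> * of_real (indicator {-\<tau>..0} \<theta> *\<^sub>R w \<theta>)) \<in> borel_measurable lebesgue"
      using h_meas borel_measurable_integrable[OF w] by measurable
    show "AE \<theta> in lebesgue. norm (h \<theta> * of_real (indicator {-\<tau>..0} \<theta> *\<^sub>R w \<theta>))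
        \<le> norm (C * (indicator {-\<tau>..0} \<theta> *\<^sub>R w \<theta>))"
    proof (rule AE_I2)
      fix \<theta> :: real
      show "norm (h \<theta> * of_real (indicator {-\<tau>..0} \<theta> *\<^sub>R w \<theta>))
          \<le> norm (C * (indicator {-\<tau>..0} \<theta> *\<^sub>R w \<theta>))"
      proof (cases "\<theta> \<in> {-\<tau>..0}")
        case True
        then have "cmod (h \<theta>) \<le> \<bar>C\<bar>"
          using C by fastforce
        then show ?thesis
          using True by (simp add: norm_mult abs_mult mult_right_mono)
      qed (auto simp: indicator_def)
    qed
  qed
  then show ?thesis
    unfolding set_integrable_def h_def
    by (rule back_subst[of "integrable lebesgue"]) (auto simp: fun_eq_iff indicator_def)
qed

lemma inner_w_add_left:
  assumes "weight_on \<tau> w"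
  shows "inner_w \<tau> w (f + g) h = inner_w \<tau> w f h + inner_w \<tau> w g h"
  unfolding inner_w_def poly_add distrib_right
  by (intro set_integral_add(2) set_integrable_poly_inner assms)

lemma inner_w_smult_left: "inner_w \<tau> w (smult c f) h = c * inner_w \<tau> w f h"
  unfolding inner_w_def by (simp add: mult.assoc flip: set_integral_mult_right)

text \<open>Both factors end up conjugated under the integral, which is then symmetric in
  \<open>f\<close> and \<open>g\<close>.\<close>

lemma inner_w_map_cnj:
  "inner_w \<tau> w (map_poly cnj f) g = inner_w \<tau> w (map_poly cnj g) f"
  unfolding inner_w_def by (simp add: mult.commute)

text \<open>\<open>norm_w\<close> takes the root of a real part; nothing is lost, because the
  integrand is real and nonnegative.\<close>

lemma inner_w_self:
  assumes "weight_on \<tau> w"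
  shows "inner_w \<tau> w f f = of_real ((norm_w \<tau> w f)\<^sup>2)"
proof -
  have "inner_w \<tau> w f f =
      set_lebesgue_integral lebesgue {-\<tau>..0} (\<lambda>\<theta>. of_real ((cmod (poly f (of_real \<theta>)))\<^sup>2 * w \<theta>))"
    unfolding inner_w_def by (simp only: complex_norm_square of_real_mult)
  also have "\<dots> = of_real (set_lebesgue_integral lebesgue {-\<tau>..0} (\<lambda>\<theta>. (cmod (poly f (of_real \<theta>)))\<^sup>2 * w \<theta>))"
    by (rule set_integral_complex_of_real)
  finally have eq: "inner_w \<tau> w f f = of_real (set_lebesgue_integral lebesgue {-\<tau>..0}
      (\<lambda>\<theta>. (cmod (poly f (of_real \<theta>)))\<^sup>2 * w \<theta>))" .
  moreover have "0 \<le> set_lebesgue_integral lebesgue {-\<tau>..0} (\<lambda>\<theta>. (cmod (poly f (of_real \<theta>)))\<^sup>2 * w \<theta>)"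
    unfolding set_lebesgue_integral_def using assms
    by (intro Bochner_Integration.integral_nonneg) (auto simp: weight_on_def indicator_def)
  ultimately show ?thesis
    by (simp add: norm_w_def)
qed

text \<open>The zero polynomial is listed separately because its degree is 0, which is not below
  \<open>n = 0\<close>.\<close>

lemma degree_diff_lead_less:
  fixes f g :: "complex poly"
  assumes "degree f \<le> n" "degree g = n" "coeff g n \<noteq> 0"
  shows "f - smult (coeff f n / coeff g n) g = 0 \<or> degree (f - smult (coeff f n / coeff g n) g) < n"
proof -
  have "degree (f - smult (coeff f n / coeff g n) g) \<le> n"
    using assms by (intro degree_diff_le) auto
  moreover have "coeff (f - smult (coeff f n / coeff g n) g) n = 0"
    using assms by simp
  ultimately show ?thesis
    by (metis leading_coeff_0_iff order_le_less)
qed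

section \<open>Orthogonality expressed by leading coefficients\<close>

context
  fixes \<tau> :: real and w :: "real \<Rightarrow> real" and \<phi> :: "nat \<Rightarrow> complex poly"
  assumes weight: "weight_on \<tau> w" and orth: "orthogonal_poly_seq \<tau> w \<phi>"
begin

lemma degree_orth [simp]: "degree (\<phi> k) = k"
  using orth by (simp add: orthogonal_poly_seq_def)

lemma inner_orth_eq_0_iff: "inner_w \<tau> w (\<phi> j) (\<phi> k) = 0 \<longleftrightarrow> j \<noteq> k"
  using orth by (simp add: orthogonal_poly_seq_def)

lemma orth_nonzero: "\<phi> k \<noteq> 0"
  using inner_orth_eq_0_iff[of k k] by (auto simp: inner_w_def)

lemma lead_coeff_orth [simp]: "coeff (\<phi> k) k \<noteq> 0"
  using leading_coeff_neq_0[OF orth_nonzero[of k]] by simp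

text \<open>Strong induction on the degree: subtracting a multiple of \<open>\<phi> m\<close>
  removes the leading term, and \<open>\<phi> m\<close> itself is orthogonal to
  \<open>\<phi> n\<close>.\<close>

lemma inner_orth_lower_degree:
  assumes "degree f < n"
  shows "inner_w \<tau> w f (\<phi> n) = 0"
  using assms
proof (induction "degree f" arbitrary: f rule: less_induct)
  case less
  define m where "m = degree f"
  define g where "g = f - smult (coeff f m / coeff (\<phi> m) m) (\<phi> m)"
  have "g = 0 \<or> degree g < m"
    unfolding g_def by (rule degree_diff_lead_less) (auto simp: m_def)
  then have "inner_w \<tau> w g (\<phi> n) = 0"
  proof
    assume "g = 0"
    then show ?thesis by (simp add: inner_w_def)
  next
    assume "degree g < m"
    with less show ?thesis by (auto simp: m_def)
  qed
  moreover have "f = smult (coeff f m / coeff (\<phi> m) m) (\<phi> m) + g"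
    by (simp add: g_def)
  moreover have "inner_w \<tau> w (\<phi> m) (\<phi> n) = 0"
    using less.prems by (simp add: inner_orth_eq_0_iff m_def)
  ultimately show ?case
    by (metis inner_w_add_left[OF weight] inner_w_smult_left add_0 mult_zero_right)
qed

lemma inner_orth:
  assumes "degree f \<le> n"
  shows "inner_w \<tau> w f (\<phi> n) = coeff f n / coeff (\<phi> n) n * inner_w \<tau> w (\<phi> n) (\<phi> n)"
proof -
  define g where "g = f - smult (coeff f n / coeff (\<phi> n) n) (\<phi> n)"
  have "g = 0 \<or> degree g < n"
    unfolding g_def using assms by (intro degree_diff_lead_less) auto
  then have "inner_w \<tau> w g (\<phi> n) = 0"
    using inner_orth_lower_degree by (auto simp: inner_w_def)
  moreover have "f = g + smult (coeff f n / coeff (\<phi> n) n) (\<phi> n)"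
    by (simp add: g_def)
  ultimately show ?thesis
    by (metis inner_w_add_left[OF weight] inner_w_smult_left add_0)
qed

text \<open>The projection coefficient reduces to a ratio of leading coefficients, so the weight
  acts only through \<open>\<phi> N\<close>.\<close>

lemma tau_trunc_eq:
  assumes "degree f \<le> N"
  shows "tau_trunc \<tau> w \<phi> N f = f - smult (coeff f N / coeff (\<phi> N) N) (\<phi> N)"
  using inner_orth_eq_0_iff[of N N] unfolding tau_trunc_def inner_w_self[OF weight, symmetric]
  by (simp add: inner_orth[OF assms])

lemma eq_0_if_orthogonal:
  assumes "\<And>k. k \<le> degree f \<Longrightarrow> inner_w \<tau> w f (\<phi> k) = 0"
  shows "f = 0"
  using assms[of "degree f"] inner_orth[of f "degree f"] inner_orth_eq_0_iff[of "degree f" "degree f"]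
  by auto

text \<open>The conjugate of \<open>\<phi> n\<close> is orthogonal to all lower degrees as well, since the weight is real.\<close>

lemma map_cnj_orth:
  obtains u where "map_poly cnj (\<phi> n) = smult u (\<phi> n)"
proof -
  have deg: "degree (map_poly cnj f) = degree f" for f :: "complex poly"
    by (intro degree_map_poly) simp
  \<comment> \<open>Chosen to match leading coefficients, so that the remainder \<open>r\<close> has
    degree below \<open>n\<close> unless it is 0.\<close>
  define u where "u = coeff (map_poly cnj (\<phi> n)) n / coeff (\<phi> n) n"
  define r where "r = map_poly cnj (\<phi> n) - smult u (\<phi> n)"
  have r_deg: "r = 0 \<or> degree r < n"
    unfolding r_def u_def by (rule degree_diff_lead_less) (auto simp: deg)
  have "r = 0"
  proof (rule ccontr)
    assume "r \<noteq> 0"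
    have "r = 0"
    proof (rule eq_0_if_orthogonal)
      fix k assume "k \<le> degree r"
      then have k: "k < n"
        using r_deg \<open>r \<noteq> 0\<close> by auto
      have "inner_w \<tau> w (map_poly cnj (\<phi> n)) (\<phi> k) = inner_w \<tau> w (map_poly cnj (\<phi> k)) (\<phi> n)"
        by (rule inner_w_map_cnj)
      also have "\<dots> = 0"
        using k by (intro inner_orth_lower_degree) (simp add: deg)
      finally have "inner_w \<tau> w (map_poly cnj (\<phi> n)) (\<phi> k) = 0" .
      moreover have "inner_w \<tau> w (\<phi> n) (\<phi> k) = 0"
        using k by (simp add: inner_orth_eq_0_iff)
      moreover have "r = map_poly cnj (\<phi> n) + smult (- u) (\<phi> n)"
        by (simp add: r_def)
      ultimately show "inner_w \<tau> w r (\<phi> k) = 0"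
        by (simp add: inner_w_add_left[OF weight] inner_w_smult_left del: smult_minus_left add_uminus_conv_diff)
    qed
    with \<open>r \<noteq> 0\<close> show False ..
  qed
  then show ?thesis
    using that by (simp add: r_def)
qed

end

subsection \<open>The transfer function of the tau discretization\<close>

text \<open>With \<open>n\<close> the degree of \<open>p\<close>, \<open>f = tau_poly p s\<close> solves \<open>s f - f' = s ^ (n + 1) p\<close>; the sum is the
  Neumann series of the inverse of \<open>s - d/d\<theta>\<close>, scaled to be polynomial in \<open>s\<close>.\<close>

definition tau_poly :: "complex poly \<Rightarrow> complex \<Rightarrow> complex poly" where
  "tau_poly p s = (\<Sum>k\<le>degree p. smult (s ^ (degree p - k)) ((pderiv ^^ k) p))"

text \<open>The value of \<open>tau_poly p s\<close> at \<open>\<theta> = 0\<close>, kept as a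
  polynomial in \<open>s\<close> so that its growth and its derivative at 0 are accessible.\<close>

definition tau_char :: "complex poly \<Rightarrow> complex poly" where
  "tau_char p = (\<Sum>k\<le>degree p. monom (poly ((pderiv ^^ k) p) 0) (degree p - k))"

lemma poly_tau_poly_0: "poly (tau_poly p s) 0 = poly (tau_char p) s"
  by (simp add: tau_poly_def tau_char_def poly_sum poly_monom mult.commute)

lemma degree_tau_poly: "degree (tau_poly p s) \<le> degree p"
  unfolding tau_poly_def
  by (intro degree_sum_le) (auto intro!: order.trans[OF degree_smult_le] simp: degree_higher_pderiv)

lemma coeff_tau_poly: "coeff (tau_poly p s) (degree p) = s ^ degree p * lead_coeff p"
proof -
  have "coeff ((pderiv ^^ k) p) (degree p) = 0" if "k \<noteq> 0" for k
  \<comment> \<open>For constant \<open>p\<close>, truncated subtraction makes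
    \<open>degree p - k\<close> equal to \<open>degree p\<close>, so the degree argument is of no
    help.\<close>
  proof (cases "degree p = 0")
    case True
    then obtain c where "p = [:c:]" by (rule degree_eq_zeroE)
    with that show ?thesis by (cases k) (simp_all add: funpow_swap1)
  next
    case False
    with that show ?thesis by (intro coeff_eq_0) (simp add: degree_higher_pderiv)
  qed
  then have "coeff (tau_poly p s) (degree p) =
      (\<Sum>k\<le>degree p. if k = 0 then s ^ degree p * lead_coeff p else 0)"
    unfolding tau_poly_def coeff_sum by (intro sum.cong) auto
  then show ?thesis by simp
qed

lemma higher_pderiv_degree: "(pderiv ^^ degree p) p = [:fact (degree p) * lead_coeff p:]"
  for p :: "complex poly"
proof -
  have "degree ((pderiv ^^ degree p) p) = 0"
    by (simp add: degree_higher_pderiv)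
  then obtain c where c: "(pderiv ^^ degree p) p = [:c:]"
    by (rule degree_eq_zeroE)
  then have "c = coeff ((pderiv ^^ degree p) p) 0" by simp
  also have "\<dots> = fact (degree p) * lead_coeff p"
    by (simp add: coeff_higher_pderiv pochhammer_fact)
  finally show ?thesis using c by simp
qed

lemma smult_sum_right: "smult c (\<Sum>k\<in>A. f k) = (\<Sum>k\<in>A. smult c (f k))"
  by (induction A rule: infinite_finite_induct) (simp_all add: smult_add_right)

text \<open>Differentiation shifts the index by one and the derivative of order
  \<open>degree p + 1\<close> vanishes. Pulling out \<open>s\<close> restores the series without its
  term for \<open>k = 0\<close>.\<close>

lemma pderiv_tau_poly:
  "pderiv (tau_poly p s) = smult s (tau_poly p s - smult (s ^ degree p) p)"
proof -
  define n where "n = degree p"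
  have "(pderiv ^^ Suc n) p = 0"
    by (simp add: n_def higher_pderiv_degree pderiv_pCons)
  then have "pderiv (tau_poly p s) = (\<Sum>k<n. smult (s ^ (n - k)) ((pderiv ^^ Suc k) p))"
    by (simp add: tau_poly_def n_def[symmetric] higher_pderiv_sum[of "Suc 0", simplified] pderiv_smult pderiv_add lessThan_Suc_atMost[symmetric])
  also have "\<dots> = smult s (\<Sum>k<n. smult (s ^ (n - Suc k)) ((pderiv ^^ Suc k) p))"
    unfolding smult_sum_right by (intro sum.cong) (auto simp: Suc_diff_Suc simp flip: power_Suc)
  also have "(\<Sum>k<n. smult (s ^ (n - Suc k)) ((pderiv ^^ Suc k) p)) = tau_poly p s - smult (s ^ n) p"
    unfolding tau_poly_def n_def[symmetric] sum.atMost_shift by simp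
  finally show ?thesis by (simp add: n_def)
qed

text \<open>At \<open>s = 0\<close> only \<open>k = degree p\<close> survives, as
  \<open>0 ^ 0 = 1\<close>, and leaves a nonzero constant; otherwise the leading coefficient is
  nonzero.\<close>

lemma tau_poly_nonzero:
  assumes "p \<noteq> 0"
  shows "tau_poly p s \<noteq> 0"
proof (cases "s = 0")
  case True
  have "tau_poly p 0 = (\<Sum>k\<le>degree p. if k = degree p then (pderiv ^^ k) p else 0)"
    unfolding tau_poly_def by (intro sum.cong) auto
  then have "tau_poly p 0 = (pderiv ^^ degree p) p"
    by simp
  then show ?thesis
    using assms True by (simp add: higher_pderiv_degree)
next
  case False
  then show ?thesis
    using coeff_tau_poly[of p s] assms by auto
qed

lemma tau_char_0:
  "poly (tau_char p) 0 = fact (degree p) * lead_coeff p"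
proof -
  have "coeff (tau_char p) 0 = (\<Sum>k\<le>degree p. if k = degree p then fact (degree p) * lead_coeff p else 0)"
    unfolding tau_char_def coeff_sum by (intro sum.cong) (auto simp: higher_pderiv_degree)
  then show ?thesis by (simp add: poly_0_coeff_0)
qed

section \<open>Symmetry about the midpoint, conjugation and growth\<close>

text \<open>Each differentiation contributes a factor -1 by the chain rule.\<close>

lemma higher_pderiv_reflect:
  fixes p :: "complex poly"
  assumes "pcompose p [:c, -1:] = smult e p"
  shows "pcompose ((pderiv ^^ k) p) [:c, -1:] = smult (e * (-1) ^ k) ((pderiv ^^ k) p)"
proof (induction k)
  case (Suc k)
  have "pderiv (pcompose ((pderiv ^^ k) p) [:c, -1:]) = - pcompose ((pderiv ^^ Suc k) p) [:c, -1:]"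
    by (simp add: pderiv_pcompose pderiv_pCons)
  also have "pderiv (pcompose ((pderiv ^^ k) p) [:c, -1:]) = smult (e * (-1) ^ k) ((pderiv ^^ Suc k) p)"
    by (simp add: Suc pderiv_smult)
  finally show ?case
    by (simp add: minus_equation_iff)
qed (use assms in auto)

context
  fixes p :: "complex poly" and \<tau> :: real
  assumes reflect: "pcompose p [:- of_real \<tau>, -1:] = smult ((-1) ^ degree p) p"
begin

lemma poly_higher_pderiv_reflect:
  "poly ((pderiv ^^ k) p) (- of_real \<tau>) = (-1) ^ degree p * (-1) ^ k * poly ((pderiv ^^ k) p) 0"
  using arg_cong[OF higher_pderiv_reflect[OF reflect, of k], of "\<lambda>q. poly q 0"]
  by (simp add: poly_pcompose)

text \<open>With \<open>n = degree p\<close>, passing from 0 to \<open>- \<tau>\<close> multiplies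
  the \<open>k\<close>-th derivative by \<open>(-1) ^ (n + k)\<close>. Since \<open>n + k\<close>
  and \<open>n - k\<close> have equal parity, the sign is absorbed by turning
  \<open>s ^ (n - k)\<close> into \<open>(- s) ^ (n - k)\<close>.\<close>

lemma poly_tau_poly_minus: "poly (tau_poly p s) (- of_real \<tau>) = poly (tau_char p) (- s)"
proof -
  have "(-1) ^ degree p * (-1) ^ k = ((-1) ^ (degree p - k) :: complex)" if "k \<le> degree p" for k
  proof -
    have "degree p + k = (degree p - k) + 2 * k" using that by simp
    then have "(-1) ^ degree p * (-1) ^ k = ((-1) ^ (degree p - k + 2 * k) :: complex)"
      by (simp only: power_add[symmetric])
    then show ?thesis by (simp add: power_add power_mult)
  qed
  then show ?thesis
    unfolding tau_poly_def tau_char_def poly_sum poly_monom poly_smult poly_higher_pderiv_reflect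
    by (intro sum.cong) (auto simp: power_minus[of s])
qed

text \<open>The linear coefficient comes from the derivative of order \<open>degree p - 1\<close>.
  That derivative is affine and odd about \<open>- \<tau> / 2\<close>, so its value at 0 is
  \<open>\<tau> / 2\<close> times its slope, and the slope is
  \<open>poly (tau_char p) 0\<close>.\<close>

lemma pderiv_tau_char:
  assumes "degree p \<ge> 1"
  shows "poly (pderiv (tau_char p)) 0 = of_real (\<tau> / 2) * poly (tau_char p) 0"
proof -
  obtain m where m: "degree p = Suc m"
    using assms by (cases "degree p") auto
  define q where "q = (pderiv ^^ m) p"
  define c where "c = fact (degree p) * lead_coeff p"
  have pq: "pderiv q = [:c:]"
    using higher_pderiv_degree[of p] by (simp add: q_def c_def m)
  have "degree q \<le> 1"
    by (simp add: q_def degree_higher_pderiv m)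
  then obtain q0 q1 where q: "q = [:q0, q1:]"
    by (metis One_nat_def coeff_pCons_0 degree_eq_zeroE degree_pCons_eq_if degree_0 le_zero_eq not_less_eq_eq pCons_cases)
  have "q1 = c"
    using pq by (simp add: q pderiv_pCons)
  have "poly q (- of_real \<tau>) = - poly q 0"
    using poly_higher_pderiv_reflect[of m] by (simp add: q_def m power_mult_distrib[symmetric])
  then have "q0 = of_real (\<tau> / 2) * c"
    by (simp add: q \<open>q1 = c\<close> field_simps)
  moreover have "coeff (tau_char p) 1 = q0"
  proof -
    have "coeff (tau_char p) 1 = (\<Sum>k\<le>degree p. if k = m then poly q 0 else 0)"
      unfolding tau_char_def coeff_sum by (intro sum.cong) (auto simp: q_def m)
    then show ?thesis by (simp add: m q)
  qed
  moreover have "poly (tau_char p) 0 = c"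
    by (simp add: tau_char_0 c_def)
  ultimately show ?thesis
    by (simp add: poly_0_coeff_0 coeff_pderiv)
qed

end

text \<open>The factors produced by differentiation are real, so all derivatives inherit the same
  \<open>u\<close>.\<close>

lemma cnj_tau_char:
  assumes "map_poly cnj p = smult u p"
  shows "cnj (poly (tau_char p) s) = u * poly (tau_char p) (cnj s)"
proof -
  have "map_poly cnj ((pderiv ^^ k) p) = smult u ((pderiv ^^ k) p)" for k
  proof (rule poly_eqI)
    fix n
    have "cnj (coeff p (n + k)) = u * coeff p (n + k)"
      using arg_cong[OF assms, of "\<lambda>q. coeff q (n + k)"] by (simp add: coeff_map_poly)
    moreover have "cnj (pochhammer (of_nat (Suc n)) k) = pochhammer (of_nat (Suc n)) k"
      by (simp add: pochhammer_of_nat del: of_nat_Suc)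
    ultimately show "coeff (map_poly cnj ((pderiv ^^ k) p)) n = coeff (smult u ((pderiv ^^ k) p)) n"
      by (simp add: coeff_map_poly coeff_higher_pderiv del: of_nat_Suc)
  qed
  then have "cnj (poly ((pderiv ^^ k) p) 0) = u * poly ((pderiv ^^ k) p) 0" for k
    using poly_cnj[of "(pderiv ^^ k) p" 0] by simp
  then show ?thesis
    by (simp add: tau_char_def poly_sum poly_monom sum_distrib_left mult.assoc)
qed

text \<open>\<open>cmod (poly p s / s ^ n)\<close> tends to the same positive limit \<open>c\<close>
  in all directions; bounds \<open>3 / 4 * c\<close> and \<open>3 / 2 * c\<close> give the factor
  2.\<close>

lemma poly_reflect_bound:
  fixes p :: "complex poly"
  assumes "p \<noteq> 0"
  obtains R where "\<And>s. R \<le> cmod s \<Longrightarrow> cmod (poly p (- s)) \<le> 2 * cmod (poly p s)"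
proof -
  define n where "n = degree p"
  define c where "c = cmod (lead_coeff p)"
  have "c > 0"
    using assms by (simp add: c_def)
  have "((\<lambda>s. cmod (poly p s / s ^ n)) \<longlongrightarrow> c) at_infinity"
    unfolding c_def n_def by (intro tendsto_norm poly_divide_tendsto_aux)
  moreover have "3 / 4 * c < c" "c < 3 / 2 * c"
    using \<open>c > 0\<close> by auto
  ultimately have "\<forall>\<^sub>F s in at_infinity. 3 / 4 * c < cmod (poly p s / s ^ n) \<and> cmod (poly p s / s ^ n) < 3 / 2 * c"
    by (intro eventually_conj order_tendstoD)
  then obtain R where R: "\<And>s. R \<le> cmod s \<Longrightarrow>
      3 / 4 * c < cmod (poly p s / s ^ n) \<and> cmod (poly p s / s ^ n) < 3 / 2 * c"
    unfolding eventually_at_infinity by blast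
  show ?thesis
  proof (rule that)
    fix s assume "max R 1 \<le> cmod s"
    then have s: "R \<le> cmod s" "R \<le> cmod (- s)" "s \<noteq> 0" by auto
    have "cmod (poly p (- s) / (- s) ^ n) \<le> 2 * cmod (poly p s / s ^ n)"
      using R[OF s(1)] R[OF \<open>R \<le> cmod (- s)\<close>] by linarith
    then show "cmod (poly p (- s)) \<le> 2 * cmod (poly p s)"
      using s by (simp add: norm_divide norm_power divide_right_mono divide_le_cancel)
  qed
qed

text \<open>The difference of both sides vanishes on an interval, which is infinite as
  \<open>\<tau> > 0\<close>. The resulting polynomial identity can be differentiated.\<close>

lemma pcompose_reflect_eq_smult:
  fixes p :: "complex poly"
  assumes "\<tau> > 0"
    and "\<And>\<theta>. \<theta> \<in> {-\<tau>..0} \<Longrightarrow> poly p (of_real (-\<tau> - \<theta>)) = e * poly p (of_real \<theta>)"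
  shows "pcompose p [:- of_real \<tau>, -1:] = smult e p"
proof (rule ccontr)
  define q where "q = pcompose p [:- of_real \<tau>, -1:] - smult e p"
  assume "pcompose p [:- of_real \<tau>, -1:] \<noteq> smult e p"
  then have "finite {x. poly q x = 0}"
    by (intro poly_roots_finite) (simp add: q_def)
  moreover have "complex_of_real ` {-\<tau>..0} \<subseteq> {x. poly q x = 0}"
    using assms(2) by (auto simp: q_def poly_pcompose)
  ultimately have "finite (complex_of_real ` {-\<tau>..0})"
    by (rule finite_subset[rotated])
  then have "finite {-\<tau>..0}"
    by (rule finite_imageD) (auto simp: inj_on_def)
  then show False
    using assms(1) by (simp add: infinite_Icc)
qed

section \<open>Inverting the tau map at \<open>(1, 0)\<close>\<close>

lemma tau_map_smult:
  "tau_map a \<tau> w \<phi> N s (smult c f) =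
    (c * fst (tau_map a \<tau> w \<phi> N s f), smult c (snd (tau_map a \<tau> w \<phi> N s f)))"
  by (simp add: tau_map_def tau_trunc_def inner_w_smult_left pderiv_smult algebra_simps smult_diff_right smult_add_right)

text \<open>The truncation subtracts exactly \<open>s ^ N * \<phi> N\<close>, the defect in the
  differential equation of \<open>tau_poly\<close>, so the second component vanishes.\<close>

lemma tau_map_tau_poly:
  assumes "weight_on \<tau> w" and "orthogonal_poly_seq \<tau> w \<phi>"
    and "pcompose (\<phi> N) [:- of_real \<tau>, -1:] = smult ((-1) ^ N) (\<phi> N)"
  shows "tau_map a \<tau> w \<phi> N s (tau_poly (\<phi> N) s) =
    ((s - of_real a) * poly (tau_char (\<phi> N)) s - of_real a * poly (tau_char (\<phi> N)) (- s), 0)"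
proof -
  have deg: "degree (\<phi> N) = N" and lead: "coeff (\<phi> N) N \<noteq> 0"
    using degree_orth[OF assms(1,2)] lead_coeff_orth[OF assms(1,2)] by auto
  have "degree (tau_poly (\<phi> N) s) \<le> N"
    using degree_tau_poly[of "\<phi> N" s] by (simp add: deg)
  then have "tau_trunc \<tau> w \<phi> N (tau_poly (\<phi> N) s) = tau_poly (\<phi> N) s - smult (s ^ N) (\<phi> N)"
    using tau_trunc_eq[OF assms(1,2), of "tau_poly (\<phi> N) s" N] coeff_tau_poly[of "\<phi> N" s] lead
    by (simp add: deg)
  moreover have "poly (tau_poly (\<phi> N) s) (- of_real \<tau>) = poly (tau_char (\<phi> N)) (- s)"
    using assms(3) by (intro poly_tau_poly_minus) (simp add: deg)
  ultimately show ?thesis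
    by (simp add: tau_map_def poly_tau_poly_0 pderiv_tau_poly deg left_diff_distrib)
qed

text \<open>If \<open>d (\<phi> N) s\<close> were 0, the nonzero \<open>tau_poly\<close> would be
  mapped to 0, against injectivity. Otherwise scaling it by the reciprocal gives the preimage of
  \<open>(1, 0)\<close>.\<close>

lemma tau_transfer_eq:
  fixes a :: real
  defines "d \<equiv> \<lambda>p s. (s - of_real a) * poly (tau_char p) s - of_real a * poly (tau_char p) (- s)"
  assumes "weight_on \<tau> w" and "orthogonal_poly_seq \<tau> w \<phi>"
    and "pcompose (\<phi> N) [:- of_real \<tau>, -1:] = smult ((-1) ^ N) (\<phi> N)"
    and inj: "inj_on (tau_map a \<tau> w \<phi> N s) (polys_upto N)"
  shows "d (\<phi> N) s \<noteq> 0 \<and> tau_transfer a \<tau> w \<phi> N s = poly (tau_char (\<phi> N)) s / d (\<phi> N) s"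
proof -
  define E where "E = tau_poly (\<phi> N) s"
  have map_E: "tau_map a \<tau> w \<phi> N s E = (d (\<phi> N) s, 0)"
    unfolding E_def d_def by (rule tau_map_tau_poly[OF assms(2-4)])
  have E: "smult c E \<in> polys_upto N" for c
    using degree_tau_poly[of "\<phi> N" s] degree_orth[OF assms(2,3), of N]
    by (simp add: polys_upto_def E_def)
  have "d (\<phi> N) s \<noteq> 0"
  proof
    assume "d (\<phi> N) s = 0"
    then have "tau_map a \<tau> w \<phi> N s (smult 1 E) = tau_map a \<tau> w \<phi> N s (smult 0 E)"
      unfolding tau_map_smult map_E by simp
    then have "smult 1 E = smult 0 E"
      using inj E unfolding inj_on_def by blast
    then show False
      using tau_poly_nonzero[OF orth_nonzero[OF assms(2,3)]] by (simp add: E_def)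
  qed
  moreover have "tau_map a \<tau> w \<phi> N s (smult (1 / d (\<phi> N) s) E) = (1, 0)"
    unfolding tau_map_smult map_E using \<open>d (\<phi> N) s \<noteq> 0\<close> by simp
  then have "inv_into (polys_upto N) (tau_map a \<tau> w \<phi> N s) (1, 0) = smult (1 / d (\<phi> N) s) E"
    using inv_into_f_f[OF inj E] by metis
  ultimately show ?thesis
    by (simp add: tau_transfer_def E_def poly_tau_poly_0)
qed

theorem proposition5p5:
  fixes a \<tau> :: real and w :: "real \<Rightarrow> real" and \<phi> :: "nat \<Rightarrow> complex poly" and N :: nat
  assumes "a < 0" and "\<tau> > 0"
    and "weight_on \<tau> w"
    and "orthogonal_poly_seq \<tau> w \<phi>"
    and "\<And>k \<theta>. \<theta> \<in> {-\<tau>..0} \<Longrightarrow>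
           poly (\<phi> k) (of_real (-\<tau> - \<theta>)) = (-1) ^ k * poly (\<phi> k) (of_real \<theta>)"
    and "N \<ge> 1"
    and "tau_exp_stable a \<tau> w \<phi> N"
  shows "H2_finite (tau_transfer a \<tau> w \<phi> N) \<and> H2_finite (delay_transfer a \<tau>) \<and>
         H2_norm (tau_transfer a \<tau> w \<phi> N) = H2_norm (delay_transfer a \<tau>)"
proof -
  define P where "P = tau_char (\<phi> N)"
  have deg: "degree (\<phi> N) = N"
    using degree_orth[OF assms(3,4)] .
  have reflect: "pcompose (\<phi> N) [:- of_real \<tau>, -1:] = smult ((-1) ^ N) (\<phi> N)"
    using assms(2,5) by (rule pcompose_reflect_eq_smult)
  obtain u where u: "map_poly cnj (\<phi> N) = smult u (\<phi> N)"
    using map_cnj_orth[OF assms(3,4)] .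
  have P0: "poly P 0 \<noteq> 0"
    using orth_nonzero[OF assms(3,4), of N] by (simp add: P_def tau_char_0)
  then have "P \<noteq> 0"
    by auto
  then obtain R where R: "\<And>s. R \<le> cmod s \<Longrightarrow> cmod (poly P (- s)) \<le> 2 * cmod (poly P s)"
    using poly_reflect_bound by blast
  have transfer: "(s - of_real a) * poly P s - of_real a * poly P (- s) \<noteq> 0 \<and> tau_transfer a \<tau> w \<phi> N s =
      poly P s / ((s - of_real a) * poly P s - of_real a * poly P (- s))" if "0 \<le> Re s" for s
    unfolding P_def using assms(3,4) reflect
    by (rule tau_transfer_eq) (use assms(7) that in \<open>auto simp: tau_exp_stable_def bij_betw_def\<close>)
  have "H2_finite (tau_transfer a \<tau> w \<phi> N) \<and>
      H2_norm (tau_transfer a \<tau> w \<phi> N) = sqrt ((a * \<tau> - 1) / (4 * a))"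
  proof (rule H2_norm_closed_loop[where P = "poly P" and u = u and R = R and M = 2])
    show "cnj (poly P (\<i> * of_real \<omega>)) = u * poly P (- (\<i> * of_real \<omega>))" for \<omega> :: real
      unfolding P_def cnj_tau_char[OF u] by simp
    \<comment> \<open>Here \<open>N \<ge> 1\<close> enters, since the derivative of order
      \<open>N - 1\<close> is evaluated.\<close>
    show "(poly P has_field_derivative of_real (\<tau> / 2) * poly P 0) (at 0)"
      using poly_DERIV[of P 0] pderiv_tau_char[of "\<phi> N" \<tau>] reflect assms(6) by (simp add: P_def deg)
    show "cmod (poly P (- s)) \<le> 2 * cmod (poly P s)" if "R \<le> cmod s" for s
      using that by (rule R)
    show "(s - of_real a) * poly P s - of_real a * poly P (- s) \<noteq> 0"
      and "tau_transfer a \<tau> w \<phi> N s =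
        poly P s / ((s - of_real a) * poly P s - of_real a * poly P (- s))" if "0 \<le> Re s" for s
      using transfer[OF that] by auto
    show "poly P holomorphic_on UNIV"
      by (intro holomorphic_intros)
  qed (use assms(1) P0 in auto)
  with delay_transfer_H2[OF assms(1,2)] show ?thesis
    by simp
qed

end
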